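(* Let $\alpha_1<\alpha_2$ and $\beta_1<\beta_2$ be real numbers, let $\phi:[\alpha_1,\alpha_2]\to[\beta_1,\beta_2]$ be a continuous (strictly) increasing function with $\phi(\alpha_i)=\beta_i$ for $i=1,2$, and let $\psi:[\beta_1,\beta_2]\to[\alpha_1,\alpha_2]$ be its inverse. For $a\in[\alpha_1,\alpha_2]$ and $b\in[\beta_1,\beta_2]$ define $$F(a,b)=\int_{\alpha_1}^{a}\phi(x)\,dx+\int_{\beta_1}^{b}\psi(x)\,dx-ab+\alpha_1\beta_1 .$$ Then for every $a\in[\alpha_1,\alpha_2]$ and $b\in[\beta_1,\beta_2]$, $$0\le F(a,b)\le -(\psi(b)-a)(\phi(a)-b),$$ where the former equality holds if and only if the latter equality holds; that is, $F(a,b)=0$ if and only if $F(a,b)=-(\psi(b)-a)(\phi(a)-b)$.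
   Context: "Increasing" means strictly increasing, as is implied by the existence of the inverse $\psi$. That $\psi$ is the inverse of $\phi$ means $\psi(\phi(\alpha))=\alpha$ for all $\alpha\in[\alpha_1,\alpha_2]$ and $\phi(\psi(\beta))=\beta$ for all $\beta\in[\beta_1,\beta_2]$. *)

theory Defs
  imports "HOL-Analysis.Analysis"
begin

(* For a < \<alpha>\<^sub>1 or b < \<beta>\<^sub>1 the corresponding integral is 0 rather than the negated
   reversed integral; only \<alpha>\<^sub>1 \<le> a and \<beta>\<^sub>1 \<le> b are of interest. *)
definition young_gap ::
  "(real \<Rightarrow> real) \<Rightarrow> (real \<Rightarrow> real) \<Rightarrow> real \<Rightarrow> real \<Rightarrow> real \<Rightarrow> real \<Rightarrow> real" where
  "young_gap \<phi> \<psi> \<alpha>\<^sub>1 \<beta>\<^sub>1 a b =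
     integral {\<alpha>\<^sub>1..a} \<phi> + integral {\<beta>\<^sub>1..b} \<psi> - a * b + \<alpha>\<^sub>1 * \<beta>\<^sub>1"

end

theory Submission
  imports Defs
begin

text \<open>
  Young's equality says that the gap vanishes on the graph of \<open>\<phi>\<close>: over a subinterval
  from \<open>x\<close> to \<open>y\<close>, bounding both integrals by their endpoint values shows that the gap along the
  graph changes by at most \<open>(y - x) (\<phi> y - \<phi> x)\<close>, so its derivative is zero.
  With \<open>b = \<phi> c\<close>, the gap at \<open>(a, b)\<close> is therefore the integral of \<open>b - \<phi>\<close> from \<open>a\<close> to \<open>c\<close>, which
  is positive unless \<open>a = c\<close>. For the upper bound, Young's equality gives
  \<open>F(a, b) + F(\<psi> b, \<phi> a) = - (\<psi> b - a) (\<phi> a - b)\<close>, and the second term is nonnegative and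
  vanishes exactly when \<open>b = \<phi> a\<close>.
\<close>

text \<open>On the open interval \<open>f\<close> lies strictly between its endpoint values, and for
  continuous integrands this suffices for strict comparison with the constants.\<close>

lemma strict_mono_integral_bounds:
  fixes f :: "real \<Rightarrow> real"
  assumes cont: "continuous_on {c..d} f" and mono: "strict_mono_on {c..d} f" and "c < d"
  shows "f c * (d - c) < integral {c..d} f" and "integral {c..d} f < f d * (d - c)"
proof -
  have "integral {c..d} (\<lambda>_. f c) < integral {c..d} f"
    using assms by (intro integral_less_real) (auto intro: strict_mono_onD[OF mono])
  moreover have "integral {c..d} f < integral {c..d} (\<lambda>_. f d)"
    using assms by (intro integral_less_real) (auto intro: strict_mono_onD[OF mono])
  ultimately show "f c * (d - c) < integral {c..d} f" "integral {c..d} f < f d * (d - c)"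
    using \<open>c < d\<close> by (auto simp: mult.commute)
qed

text \<open>Dividing by \<open>y - x\<close> bounds the difference quotient of \<open>f\<close> by
  an increment of \<open>g\<close>, which tends to 0 by continuity. Differentiability of
  \<open>f\<close> is thus a conclusion, with derivative zero on a convex set.\<close>

lemma constant_if_increment_le_product:
  fixes f g :: "real \<Rightarrow> real"
  assumes "convex S" and cont: "continuous_on S g"
    and le: "\<And>x y. x \<in> S \<Longrightarrow> y \<in> S \<Longrightarrow> x < y \<Longrightarrow> \<bar>f y - f x\<bar> \<le> (y - x) * \<bar>g y - g x\<bar>"
    and "x \<in> S" "y \<in> S"
  shows "f x = f y"
proof -
  have "(f has_field_derivative 0) (at u within S)" if u: "u \<in> S" for u
    unfolding has_field_derivative_iff
  proof (rule Lim_null_comparison)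
    show "((\<lambda>v. \<bar>g v - g u\<bar>) \<longlongrightarrow> 0) (at u within S)"
      using cont u by (auto simp: continuous_on_def intro!: tendsto_eq_intros)
    have "norm ((f v - f u) / (v - u)) \<le> \<bar>g v - g u\<bar>" if v: "v \<in> S" "v \<noteq> u" for v
    proof -
      have "\<bar>f v - f u\<bar> \<le> \<bar>v - u\<bar> * \<bar>g v - g u\<bar>"
        using le[of u v] le[of v u] u v by (cases "u < v") (auto simp: abs_minus_commute)
      then show ?thesis
        using v by (simp add: abs_divide divide_le_eq mult.commute)
    qed
    then show "\<forall>\<^sub>F v in at u within S. norm ((f v - f u) / (v - u)) \<le> \<bar>g v - g u\<bar>"
      by (auto simp: eventually_at_filter)
  qed
  with has_field_derivative_zero_constant[OF \<open>convex S\<close>] assms(4,5) show ?thesis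
    by metis
qed

text \<open>The range has endpoints \<open>\<phi> p\<close> and \<open>\<phi> q\<close>, so its
  points can be written \<open>\<phi> x\<close> and claims about \<psi> become claims about
  \<phi>.\<close>

locale increasing_inverse_pair =
  fixes p q :: real and \<phi> \<psi> :: "real \<Rightarrow> real"
  assumes cont: "continuous_on {p..q} \<phi>"
    and mono: "strict_mono_on {p..q} \<phi>"
    and inverse: "\<And>x. x \<in> {p..q} \<Longrightarrow> \<psi> (\<phi> x) = x"
    and less: "p < q"
begin

lemma less_iff: "x \<in> {p..q} \<Longrightarrow> y \<in> {p..q} \<Longrightarrow> \<phi> x < \<phi> y \<longleftrightarrow> x < y"
  using strict_mono_on_less[OF mono] by blast

lemma le_iff: "x \<in> {p..q} \<Longrightarrow> y \<in> {p..q} \<Longrightarrow> \<phi> x \<le> \<phi> y \<longleftrightarrow> x \<le> y"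
  using strict_mono_on_less_eq[OF mono] by blast

lemma image: "\<phi> ` {p..q} = {\<phi> p..\<phi> q}"
proof
  show "\<phi> ` {p..q} \<subseteq> {\<phi> p..\<phi> q}"
    using le_iff less by auto
  show "{\<phi> p..\<phi> q} \<subseteq> \<phi> ` {p..q}"
    using IVT'[of \<phi> p _ q] cont less by (force simp: image_iff)
qed

lemma cont_inverse: "continuous_on {\<phi> p..\<phi> q} \<psi>"
  using continuous_on_inv[OF cont compact_Icc] inverse image by metis

lemma mono_inverse: "strict_mono_on {\<phi> p..\<phi> q} \<psi>"
  unfolding image[symmetric] by (auto intro!: strict_mono_onI simp: inverse less_iff)

lemma integral_split:
  assumes "x \<in> {p..q}" "y \<in> {p..q}" "x \<le> y"
  shows "integral {p..y} \<phi> = integral {p..x} \<phi> + integral {x..y} \<phi>"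
    and "integral {\<phi> p..\<phi> y} \<psi> = integral {\<phi> p..\<phi> x} \<psi> + integral {\<phi> x..\<phi> y} \<psi>"
proof -
  have "\<phi> integrable_on {p..y}"
    using assms by (auto intro!: integrable_continuous_real continuous_on_subset[OF cont])
  then show "integral {p..y} \<phi> = integral {p..x} \<phi> + integral {x..y} \<phi>"
    using assms Henstock_Kurzweil_Integration.integral_combine[of p x y \<phi>] by simp
  have "\<phi> p \<le> \<phi> x" "\<phi> x \<le> \<phi> y" "\<phi> y \<le> \<phi> q"
    using assms le_iff by auto
  moreover from this have "\<psi> integrable_on {\<phi> p..\<phi> y}"
    by (auto intro!: integrable_continuous_real continuous_on_subset[OF cont_inverse])
  ultimately show "integral {\<phi> p..\<phi> y} \<psi> = integral {\<phi> p..\<phi> x} \<psi> + integral {\<phi> x..\<phi> y} \<psi>"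
    using Henstock_Kurzweil_Integration.integral_combine[of "\<phi> p" "\<phi> x" "\<phi> y" \<psi>] by simp
qed

lemma integral_bounds:
  assumes "x \<in> {p..q}" "y \<in> {p..q}" "x < y"
  shows "\<phi> x * (y - x) < integral {x..y} \<phi>" and "integral {x..y} \<phi> < \<phi> y * (y - x)"
    and "x * (\<phi> y - \<phi> x) < integral {\<phi> x..\<phi> y} \<psi>"
    and "integral {\<phi> x..\<phi> y} \<psi> < y * (\<phi> y - \<phi> x)"
proof -
  have sub: "{x..y} \<subseteq> {p..q}" "{\<phi> x..\<phi> y} \<subseteq> {\<phi> p..\<phi> q}" and "\<phi> x < \<phi> y"
    using assms le_iff less_iff by auto
  show "\<phi> x * (y - x) < integral {x..y} \<phi>" "integral {x..y} \<phi> < \<phi> y * (y - x)"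
    using strict_mono_integral_bounds[of x y \<phi>] continuous_on_subset[OF cont sub(1)]
      monotone_on_subset[OF mono sub(1)] \<open>x < y\<close> by auto
  \<comment> \<open>The endpoint values of \<psi> on this interval are \<open>x\<close> and
    \<open>y\<close>.\<close>
  show "x * (\<phi> y - \<phi> x) < integral {\<phi> x..\<phi> y} \<psi>"
    "integral {\<phi> x..\<phi> y} \<psi> < y * (\<phi> y - \<phi> x)"
    using strict_mono_integral_bounds[of "\<phi> x" "\<phi> y" \<psi>] continuous_on_subset[OF cont_inverse sub(2)]
      monotone_on_subset[OF mono_inverse sub(2)] \<open>\<phi> x < \<phi> y\<close> inverse assms by auto
qed

lemma young_equality:
  assumes "x \<in> {p..q}"
  shows "young_gap \<phi> \<psi> p (\<phi> p) x (\<phi> x) = 0"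
proof -
  define H where "H x = young_gap \<phi> \<psi> p (\<phi> p) x (\<phi> x)" for x
  have "\<bar>H v - H u\<bar> \<le> (v - u) * \<bar>\<phi> v - \<phi> u\<bar>" if "u \<in> {p..q}" "v \<in> {p..q}" "u < v" for u v
  proof -
    have "H v - H u = integral {u..v} \<phi> + integral {\<phi> u..\<phi> v} \<psi> - v * \<phi> v + u * \<phi> u"
      using integral_split[of u v] that by (simp add: H_def young_gap_def)
    moreover have "\<phi> u < \<phi> v"
      using that less_iff by blast
    \<comment> \<open>Write \<open>v * \<phi> v - u * \<phi> u\<close> as
      \<open>\<phi> v * (v - u) + u * (\<phi> v - \<phi> u)\<close>. The upper bounds then leave
      \<open>(v - u) * (\<phi> v - \<phi> u)\<close>, and the lower bounds its negative.\<close>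
    ultimately show ?thesis
      using integral_bounds[OF that] by (simp add: abs_le_iff algebra_simps)
  qed
  then have "H x = H p"
    using assms less by (intro constant_if_increment_le_product[OF _ cont]) auto
  \<comment> \<open>At \<open>p\<close> both integrals run over a single point and the products
    cancel.\<close>
  then show ?thesis
    by (simp add: H_def young_gap_def)
qed

text \<open>Subtracting Young's equality at \<open>c\<close> removes the integral of \<psi>. For
  \<open>a < c\<close> this leaves \<open>\<phi> c * (c - a)\<close> minus the integral of \<phi>
  over \<open>{a..c}\<close>; for \<open>c < a\<close> both signs flip.\<close>

lemma young_gap_pos:
  assumes "a \<in> {p..q}" "c \<in> {p..q}" "a \<noteq> c"
  shows "0 < young_gap \<phi> \<psi> p (\<phi> p) a (\<phi> c)"
proof (cases "a < c")
  case True
  then show ?thesis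
    using young_equality[of c] integral_split(1)[of a c] integral_bounds(2)[of a c] assms
    by (simp add: young_gap_def algebra_simps)
next
  case False
  then show ?thesis
    using young_equality[of c] integral_split(1)[of c a] integral_bounds(1)[of c a] assms
    by (simp add: young_gap_def algebra_simps)
qed

text \<open>The four integrals regroup into the gaps at \<open>(a, \<phi> a)\<close> and
  \<open>(c, \<phi> c)\<close>, which vanish; only products remain.\<close>

lemma young_gap_swap:
  assumes "a \<in> {p..q}" "c \<in> {p..q}"
  shows "young_gap \<phi> \<psi> p (\<phi> p) a (\<phi> c) + young_gap \<phi> \<psi> p (\<phi> p) c (\<phi> a)
    = - ((c - a) * (\<phi> a - \<phi> c))"
  using young_equality[of a] young_equality[of c] assms
  by (simp add: young_gap_def algebra_simps)

end

theorem theorem1p1: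
  fixes \<alpha>\<^sub>1 \<alpha>\<^sub>2 \<beta>\<^sub>1 \<beta>\<^sub>2 a b :: real
    and \<phi> \<psi> :: "real \<Rightarrow> real"
  assumes "\<alpha>\<^sub>1 < \<alpha>\<^sub>2" and "\<beta>\<^sub>1 < \<beta>\<^sub>2"
    and "\<phi> \<in> {\<alpha>\<^sub>1..\<alpha>\<^sub>2} \<rightarrow> {\<beta>\<^sub>1..\<beta>\<^sub>2}"
    and "continuous_on {\<alpha>\<^sub>1..\<alpha>\<^sub>2} \<phi>"
    and "strict_mono_on {\<alpha>\<^sub>1..\<alpha>\<^sub>2} \<phi>"
    and "\<phi> \<alpha>\<^sub>1 = \<beta>\<^sub>1" and "\<phi> \<alpha>\<^sub>2 = \<beta>\<^sub>2"
    and "\<psi> \<in> {\<beta>\<^sub>1..\<beta>\<^sub>2} \<rightarrow> {\<alpha>\<^sub>1..\<alpha>\<^sub>2}"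
    and "\<forall>\<alpha>\<in>{\<alpha>\<^sub>1..\<alpha>\<^sub>2}. \<psi> (\<phi> \<alpha>) = \<alpha>"
    and "\<forall>\<beta>\<in>{\<beta>\<^sub>1..\<beta>\<^sub>2}. \<phi> (\<psi> \<beta>) = \<beta>"
    and "a \<in> {\<alpha>\<^sub>1..\<alpha>\<^sub>2}" and "b \<in> {\<beta>\<^sub>1..\<beta>\<^sub>2}"
  shows "0 \<le> young_gap \<phi> \<psi> \<alpha>\<^sub>1 \<beta>\<^sub>1 a b
       \<and> young_gap \<phi> \<psi> \<alpha>\<^sub>1 \<beta>\<^sub>1 a b \<le> - ((\<psi> b - a) * (\<phi> a - b))
       \<and> (young_gap \<phi> \<psi> \<alpha>\<^sub>1 \<beta>\<^sub>1 a b = 0 \<longleftrightarrow>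
            young_gap \<phi> \<psi> \<alpha>\<^sub>1 \<beta>\<^sub>1 a b = - ((\<psi> b - a) * (\<phi> a - b)))"
proof -
  interpret increasing_inverse_pair \<alpha>\<^sub>1 \<alpha>\<^sub>2 \<phi> \<psi>
    using assms by unfold_locales auto
  define c where "c = \<psi> b"
  have c: "c \<in> {\<alpha>\<^sub>1..\<alpha>\<^sub>2}" "\<phi> c = b"
    using assms by (auto simp: c_def)
  show ?thesis
  \<comment> \<open>If \<open>a = c\<close>, the gap and its upper bound are both 0. Otherwise both
    swapped gaps are positive, so both inequalities are strict and both equalities fail.\<close>
  proof (cases "a = c")
    case True
    then show ?thesis
      using young_equality[of c] c assms(6) by (simp add: c_def)
  next
    case False
    then show ?thesis
      using young_gap_pos[of a c] young_gap_pos[of c a] young_gap_swap[of a c] c assms(6,11)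
      by (simp add: c_def)
  qed
qed

end
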